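(* For integers $n,k\geq 1$ and $\lambda\in\mathbb{C}$, $$G_{k}^{(n+1)}(\lambda)=2kG_{k-1}^{(n)}(\lambda)-\Big(2-\frac{2k}{n}\Big)G_{k}^{(n)}(\lambda).$$
   Context: Apostol-Genocchi numbers of order $n$: $\Big(\frac{2t}{\lambda e^{t}+1}\Big)^{n}=\sum_{k\ge0}G_{k}^{(n)}(\lambda)\frac{t^{k}}{k!}$. *)

theory Defs
  imports Complex_Main "HOL-Computational_Algebra.Formal_Power_Series"
begin

text \<open>
  The generating function \<open>2t / (lam e\<^sup>t + 1)\<close> is read as a formal power series in \<open>t\<close>. For
  \<open>lam = -1\<close> the denominator has no constant term, but its \<open>t\<close>-coefficient is \<open>-1\<close>, so
  division of power series over a field cancels the common factor \<open>t\<close>. The quotient is therefore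
  exact for every complex \<open>lam\<close>; see \<open>apostol_genocchi_gf_mult\<close> below.
\<close>

definition apostol_genocchi_gf :: "complex \<Rightarrow> complex fps" where
  "apostol_genocchi_gf lam = (2 * fps_X) / (fps_const lam * fps_exp 1 + 1)"

lemma apostol_genocchi_gf_mult:
  "apostol_genocchi_gf lam * (fps_const lam * fps_exp 1 + 1) = 2 * fps_X"
proof -
  let ?d = "fps_const lam * fps_exp 1 + 1 :: complex fps"
  have nz: "fps_nth ?d 0 \<noteq> 0 \<or> fps_nth ?d 1 \<noteq> 0"
    by (cases "lam = 0") (auto simp: add_eq_0_iff)
  then have "?d \<noteq> 0" by (metis fps_zero_nth)
  have "subdegree ?d \<le> 1" using nz by (metis le_zero_eq subdegree_leI zero_le_one)
  also have "1 = subdegree (2 * fps_X :: complex fps)"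
    by (simp add: subdegree_mult flip: numeral_fps_const)
  finally have "?d dvd 2 * fps_X"
    using \<open>?d \<noteq> 0\<close> by (subst fps_dvd_iff) auto
  then show ?thesis by (simp add: apostol_genocchi_gf_def)
qed

definition apostol_genocchi :: "nat \<Rightarrow> complex \<Rightarrow> nat \<Rightarrow> complex" where
  "apostol_genocchi n lam k = fact k * fps_nth (apostol_genocchi_gf lam ^ n) k"

lemma apostol_genocchi_egf:
  "apostol_genocchi_gf lam ^ n = Abs_fps (\<lambda>k. apostol_genocchi n lam k / fact k)"
  by (simp add: fps_eq_iff apostol_genocchi_def)

end

theory Submission
  imports Defs
begin

text \<open>
  Differentiating \<open>g * (lam e\<^sup>t + 1) = 2t\<close> and multiplying by \<open>g\<close> eliminates \<open>lam\<close> and gives the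
  Riccati equation \<open>g\<^sup>2 = 2t g' + 2t g - 2g\<close>. Multiplied by \<open>n g\<^sup>n\<^sup>-\<^sup>1\<close>, it becomes linear in
  \<open>g\<^sup>n\<close> and \<open>(g\<^sup>n)'\<close>, and the recurrence follows by comparing coefficients.
\<close>

lemma apostol_genocchi_gf_riccati:
  "apostol_genocchi_gf lam ^ 2 =
     2 * fps_X * fps_deriv (apostol_genocchi_gf lam)
     + 2 * fps_X * apostol_genocchi_gf lam - 2 * apostol_genocchi_gf lam"
proof -
  define g where "g = apostol_genocchi_gf lam"
  define d :: "complex fps" where "d = fps_const lam * fps_exp 1 + 1"
  have gd: "g * d = 2 * fps_X"
    unfolding g_def d_def by (rule apostol_genocchi_gf_mult)
  \<comment> \<open>Since \<open>fps_exp 1\<close> is its own derivative, the derivative of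
    \<open>d\<close> is expressed through \<open>d\<close> alone, without
    \<open>lam\<close>.\<close>
  have "fps_deriv d = d - 1"
    by (simp add: d_def)
  moreover have "fps_deriv (g * d) = 2"
    unfolding gd by (simp flip: numeral_fps_const)
  ultimately have deriv: "g * (d - 1) + fps_deriv g * d = 2"
    by simp
  \<comment> \<open>The extra factor \<open>g\<close> lets each \<open>d\<close> be absorbed into
    \<open>g * d\<close>, which is \<open>2 * fps_X\<close>.\<close>
  have "2 * g = g * (g * (d - 1) + fps_deriv g * d)"
    by (simp add: deriv)
  also have "\<dots> = g * (g * d) - g ^ 2 + fps_deriv g * (g * d)"
    by (simp add: algebra_simps power2_eq_square)
  finally show ?thesis
    unfolding g_def[symmetric] gd by (simp add: algebra_simps)
qed

lemma apostol_genocchi_gf_power_Suc: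
  assumes "n \<ge> 1"
  shows "of_nat n * apostol_genocchi_gf lam ^ (n + 1) =
     2 * (fps_X * fps_deriv (apostol_genocchi_gf lam ^ n))
     + of_nat n * (2 * (fps_X * apostol_genocchi_gf lam ^ n) - 2 * apostol_genocchi_gf lam ^ n)"
proof -
  define g where "g = apostol_genocchi_gf lam"
  obtain m where n: "n = Suc m"
    using assms by (cases n) auto
  have deriv: "fps_deriv (g ^ n) = of_nat n * g ^ m * fps_deriv g"
    by (simp add: n fps_deriv_power fps_of_nat del: of_nat_Suc power_Suc)
  have "of_nat n * g ^ (n + 1) = of_nat n * g ^ m * g ^ 2"
    by (simp add: n power2_eq_square algebra_simps)
  also have "\<dots> = of_nat n * g ^ m * (2 * fps_X * fps_deriv g + 2 * fps_X * g - 2 * g)"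
    by (simp only: g_def apostol_genocchi_gf_riccati)
  also have "\<dots> = 2 * (fps_X * fps_deriv (g ^ n)) + of_nat n * (2 * (fps_X * g ^ n) - 2 * g ^ n)"
    by (simp only: deriv) (simp add: n algebra_simps del: of_nat_Suc)
  finally show ?thesis
    by (simp only: g_def)
qed

theorem theorem2p15:
  fixes n k :: nat and lam :: complex
  assumes "n \<ge> 1" and "k \<ge> 1"
  shows "apostol_genocchi (n + 1) lam k =
           2 * of_nat k * apostol_genocchi n lam (k - 1)
           - (2 - 2 * of_nat k / of_nat n) * apostol_genocchi n lam k"
proof -
  define a where "a i = fps_nth (apostol_genocchi_gf lam ^ n) i" for i
  define b where "b = fps_nth (apostol_genocchi_gf lam ^ (n + 1)) k"
  obtain j where k: "k = Suc j"
    using assms(2) by (cases k) auto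
  \<comment> \<open>On the left \<open>2\<close> is a power series, on the right a scalar.\<close>
  have nth_double: "fps_nth (2 * f) i = 2 * fps_nth f i" for f :: "complex fps" and i
    by (simp only: mult_2 fps_add_nth)
  have "of_nat n * b = fps_nth (of_nat n * apostol_genocchi_gf lam ^ (n + 1)) k"
    by (simp add: b_def flip: fps_of_nat)
  \<comment> \<open>The factor \<open>fps_X\<close> undoes the index shift of the derivative, which
    leaves \<open>of_nat k * a k\<close>; on the undifferentiated power it lowers the index from
    \<open>k\<close> to \<open>j\<close>.\<close>
  also have "\<dots> = 2 * of_nat k * a k + of_nat n * (2 * a j - 2 * a k)"
    unfolding apostol_genocchi_gf_power_Suc[OF assms(1)]
    by (simp add: a_def k nth_double flip: fps_of_nat del: of_nat_Suc)
  finally have "b = 2 * of_nat k / of_nat n * a k + 2 * a j - 2 * a k"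
    using assms(1) by (simp add: field_simps)
  \<comment> \<open>Passing from \<open>fact k * a j\<close> to \<open>fact j * a j\<close> produces
    the factor \<open>k\<close> of the lower-index term.\<close>
  moreover have "(fact k :: complex) = of_nat k * fact j"
    by (simp add: k)
  moreover have "apostol_genocchi n lam (k - 1) = fact j * a j"
    and "apostol_genocchi n lam k = fact k * a k"
    and "apostol_genocchi (n + 1) lam k = fact k * b"
    by (simp_all only: apostol_genocchi_def a_def b_def k diff_Suc_1)
  ultimately show ?thesis
    by (simp add: ring_distribs)
qed

end
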